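(* For each edit type $\mathrm{edit} \in \{\mathrm{sub}, \mathrm{ins}, \mathrm{del}\}$, $\mathrm{AS}_{\mathrm{edit}}(b, n) = O(\sqrt{n})$, where $b(T)$ is the size of a smallest valid bidirectional macro scheme of $T$.
   Context: Strings are finite sequences over an alphabet; $T[i..j]$ is the substring from position $i$ to $j$. A bidirectional macro scheme of a string $T$ of length $n$ is a factorization $T = f_1 \cdots f_b$ into nonempty phrases $f_k = T[p_k..p_k+|f_k|-1]$, where each phrase is either a single character (a ground phrase) or is a copy of a substring $T[q_k..q_k+|f_k|-1]$ (its source), with $q_k \neq p_k$, which may lie to the left or right of it. It induces the map $F:[1,n]\to[0,n]$ with $F(p_k)=0$ for a ground phrase and $F(p_k+j)=q_k+j$ for $0\le j<|f_k|$ for a non-ground phrase, and $F(0)=0$. The scheme is valid if for every $i\in[1,n]$ there is $m\ge 1$ with $F^m(i)=0$. Its size is the number $b$ of phrases; $b(T)$ is the minimum size of a valid bidirectional macro scheme of $T$. For a measure $c$ on strings, $\mathrm{AS}_{\mathrm{edit}}(c,n) = \max\{ c(T') - c(T) \}$ over all strings $T$ of length $n$ and all $T'$ obtained from $T$ by a single edit of the given type: substitution of one character, insertion of one character, or deletion of one character. *)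

theory Defs
  imports Complex_Main "HOL-Library.Landau_Symbols"
begin

text \<open>
  Strings are lists. Text positions are 1-based, so that 0 can serve as the sink of the map
  \<open>F\<close> of a bidirectional macro scheme. Phrases are numbered from 0.
\<close>

definition substring :: "'a list \<Rightarrow> nat \<Rightarrow> nat \<Rightarrow> 'a list" where
  "substring T i j = take (Suc j - i) (drop (i - 1) T)"

definition phrase_start :: "'a list list \<Rightarrow> nat \<Rightarrow> nat" where
  "phrase_start fs k = 1 + (\<Sum>j<k. length (fs ! j))"

text \<open>
  A scheme is a factorization \<open>fs\<close> together with a list \<open>qs\<close> that gives, for each phrase, \<open>None\<close> if
  it is a ground phrase and \<open>Some q\<close> if it is copied from the source starting at position \<open>q\<close>.
\<close>

definition bms :: "'a list \<Rightarrow> 'a list list \<Rightarrow> nat option list \<Rightarrow> bool" where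
  "bms T fs qs \<longleftrightarrow> concat fs = T \<and> length qs = length fs \<and>
     (\<forall>k<length fs. fs ! k \<noteq> [] \<and>
        (case qs ! k of
           None \<Rightarrow> length (fs ! k) = 1
         | Some q \<Rightarrow> 1 \<le> q \<and> q + length (fs ! k) - 1 \<le> length T \<and> q \<noteq> phrase_start fs k \<and>
             fs ! k = substring T q (q + length (fs ! k) - 1)))"

definition phrase_at :: "'a list list \<Rightarrow> nat \<Rightarrow> nat" where
  "phrase_at fs i = (THE k. k < length fs \<and> phrase_start fs k \<le> i \<and>
     i < phrase_start fs k + length (fs ! k))"

text \<open>The value 0 beyond the end of the text is a dummy: the map sends \<open>[0,n]\<close> to \<open>[0,n]\<close>.\<close>

definition bms_map :: "'a list list \<Rightarrow> nat option list \<Rightarrow> nat \<Rightarrow> nat" where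
  "bms_map fs qs i =
     (if i \<in> {1..length (concat fs)} then
        (case qs ! phrase_at fs i of
           None \<Rightarrow> 0
         | Some q \<Rightarrow> q + (i - phrase_start fs (phrase_at fs i)))
      else 0)"

definition valid_bms :: "'a list \<Rightarrow> 'a list list \<Rightarrow> nat option list \<Rightarrow> bool" where
  "valid_bms T fs qs \<longleftrightarrow> bms T fs qs \<and>
     (\<forall>i\<in>{1..length T}. \<exists>m\<ge>1. (bms_map fs qs ^^ m) i = 0)"

definition min_bms :: "'a list \<Rightarrow> nat" where
  "min_bms T = (LEAST s. \<exists>fs qs. valid_bms T fs qs \<and> length fs = s)"

datatype edit = Sub | Ins | Del

fun edits :: "edit \<Rightarrow> 'a list \<Rightarrow> 'a list set" where
  "edits Sub T = {T[i := c] | i c. i < length T \<and> c \<noteq> T ! i}"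
| "edits Ins T = {take i T @ c # drop i T | i c. i \<le> length T}"
| "edits Del T = {take i T @ drop (Suc i) T | i. i < length T}"

definition edit_diffs :: "edit \<Rightarrow> ('a list \<Rightarrow> nat) \<Rightarrow> nat \<Rightarrow> int set" where
  "edit_diffs e c n = {int (c T') - int (c T) | T T'. length T = n \<and> T' \<in> edits e T}"

text \<open>
  No edit exists for substitution or deletion when \<open>n = 0\<close>, nor for substitution over a
  one-letter alphabet; the maximum is then taken to be 0. For \<open>c = min_bms\<close> the set of differences is
  always finite (\<open>finite_edit_diffs_min_bms\<close> below), also over an infinite alphabet.
\<close>

definition AS :: "edit \<Rightarrow> ('a list \<Rightarrow> nat) \<Rightarrow> nat \<Rightarrow> int" where
  "AS e c n = (if edit_diffs e c n = {} then 0 else Max (edit_diffs e c n))"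

lemma valid_bms_all_ground:
  "valid_bms T (map (\<lambda>x. [x]) T) (replicate (length T) None)"
proof -
  let ?fs = "map (\<lambda>x. [x]) T" and ?qs = "replicate (length T) (None :: nat option)"
  have bms: "bms T ?fs ?qs"
    by (auto simp: bms_def)
  have F: "bms_map ?fs ?qs i = 0" if i: "i \<in> {1..length T}" for i
  proof -
    have st: "phrase_start ?fs k = Suc k" if "k < length T" for k
      using that by (simp add: phrase_start_def)
    have "phrase_at ?fs i = i - 1"
      unfolding phrase_at_def
      by (rule the_equality) (use i st in auto)
    then show ?thesis
      using i by (auto simp: bms_map_def)
  qed
  have "(bms_map ?fs ?qs ^^ 1) i = 0" if "i \<in> {1..length T}" for i
    using F[OF that] by simp
  then show ?thesis
    unfolding valid_bms_def using bms by blast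
qed

lemma min_bms_le_length: "min_bms T \<le> length T"
  unfolding min_bms_def by (rule Least_le) (use valid_bms_all_ground[of T] in fastforce)

lemma length_edits: "T' \<in> edits e T \<Longrightarrow> length T' \<le> Suc (length T)"
  by (cases e) auto

lemma finite_edit_diffs_min_bms: "finite (edit_diffs e (min_bms :: 'a list \<Rightarrow> nat) n)"
proof (rule finite_subset)
  show "edit_diffs e (min_bms :: 'a list \<Rightarrow> nat) n \<subseteq> {- int n..int (Suc n)}"
  proof
    fix d assume "d \<in> edit_diffs e (min_bms :: 'a list \<Rightarrow> nat) n"
    then obtain T T' :: "'a list" where
      d: "d = int (min_bms T') - int (min_bms T)" "length T = n" "T' \<in> edits e T"
      unfolding edit_diffs_def by blast
    then show "d \<in> {- int n..int (Suc n)}"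
      using min_bms_le_length[of T] min_bms_le_length[of T'] length_edits[OF d(3)] by auto
  qed
qed simp

end

theory Submission
  imports Defs
begin

text \<open>
  An edit only harms the phrases whose source crosses the edited position \<open>p\<close>. Make the edited
  position a phrase of its own, and among the harmed phrases with the same source start \<open>q\<close> pick a
  longest one. The others can copy from it instead of from the text around \<open>p\<close>; the representative
  itself is cut at \<open>p\<close>, which costs a constant number of phrases. Only one detour is
  added to each chain of references, so the scheme stays valid. The \<open>m\<close> representatives are disjoint
  and have lengths exceeding the distinct numbers \<open>p - q \<ge> 0\<close>, so \<open>m (m - 1) / 2 \<le> n\<close> and
  \<open>m = O(sqrt n)\<close>. The inverse of an edit is an edit, which also bounds the difference from below.
\<close>

text \<open>
  Positions are 0-based from here on, and \<open>None\<close> marks ground positions. The rank \<open>h\<close> witnesses that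
  every chain of references ends.
\<close>

definition macro_map :: "'a list \<Rightarrow> (nat \<Rightarrow> nat option) \<Rightarrow> bool" where
  "macro_map T F \<longleftrightarrow> (\<exists>h::nat \<Rightarrow> nat. \<forall>i<length T. \<forall>j. F i = Some j \<longrightarrow>
     j < length T \<and> T ! j = T ! i \<and> h j < h i)"

text \<open>The starts of the phrases in the coarsest factorization compatible with \<open>F\<close>.\<close>

definition breaks :: "nat \<Rightarrow> (nat \<Rightarrow> nat option) \<Rightarrow> nat set" where
  "breaks n F = {i. i < n \<and> (i = 0 \<or> \<not> (\<exists>j. F (i - 1) = Some j \<and> F i = Some (Suc j)))}"

lemma finite_breaks [simp]: "finite (breaks n F)"
  by (rule finite_subset[of _ "{..<n}"]) (auto simp: breaks_def)

lemma nonbreakD: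
  assumes "Suc i \<notin> breaks n F" "Suc i < n"
  obtains j where "F i = Some j" "F (Suc i) = Some (Suc j)"
  using assms by (auto simp: breaks_def)

section \<open>Phrases and breaks\<close>

lemma phrase_start_eq:
  "k \<le> length fs \<Longrightarrow> phrase_start fs k = Suc (length (concat (take k fs)))"
  by (simp add: phrase_start_def length_concat sum_list_sum_nth atLeast0LessThan)

lemma phrase_start_Suc: "phrase_start fs (Suc k) = phrase_start fs k + length (fs ! k)"
  by (simp add: phrase_start_def)

lemma phrase_start_mono: "k \<le> l \<Longrightarrow> phrase_start fs k \<le> phrase_start fs l"
  unfolding phrase_start_def by (intro add_left_mono sum_mono2) auto

lemma nth_phrase:
  assumes "k < length fs" "t < length (fs ! k)"
  shows "concat fs ! (phrase_start fs k - 1 + t) = fs ! k ! t"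
    and "phrase_start fs k + t \<le> length (concat fs)"
proof -
  have c: "concat fs = concat (take k fs) @ fs ! k @ concat (drop (Suc k) fs)"
    by (metis assms(1) concat.simps(2) concat_append id_take_nth_drop)
  show "concat fs ! (phrase_start fs k - 1 + t) = fs ! k ! t"
    using assms by (subst c) (simp add: phrase_start_eq nth_append)
  show "phrase_start fs k + t \<le> length (concat fs)"
    using assms by (subst c) (simp add: phrase_start_eq)
qed

lemma phrase_at_eqI:
  assumes "k < length fs" "t < length (fs ! k)"
  shows "phrase_at fs (phrase_start fs k + t) = k"
  unfolding phrase_at_def
proof (rule the_equality)
  fix l
  assume l: "l < length fs \<and> phrase_start fs l \<le> phrase_start fs k + t \<and>
    phrase_start fs k + t < phrase_start fs l + length (fs ! l)"
  show "l = k"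
    using phrase_start_mono[of "Suc l" k fs] phrase_start_mono[of "Suc k" l fs] l assms
    by (cases l k rule: linorder_cases) (auto simp: phrase_start_Suc)
qed (use assms in auto)

lemma ex_phrase:
  assumes "i < length (concat fs)"
  obtains k t where "k < length fs" "t < length (fs ! k)" "i = phrase_start fs k - 1 + t"
proof -
  \<comment> \<open>The phrase whose successor is the first to start beyond \<open>i\<close>.
    Subtracting 1 turns the 1-based \<open>phrase_start\<close> into a 0-based position.\<close>
  define k where "k = (LEAST k. i < phrase_start fs (Suc k) - 1)"
  have ne: "length fs > 0" using assms by (cases fs) auto
  have "i < phrase_start fs (Suc (length fs - 1)) - 1"
    using assms ne by (simp add: phrase_start_eq)
  then have k: "i < phrase_start fs (Suc k) - 1" "k \<le> length fs - 1"
    unfolding k_def by (rule LeastI, rule Least_le)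
  have "phrase_start fs k - 1 \<le> i"
  proof (cases k)
    case (Suc l)
    then show ?thesis using not_less_Least[of l "\<lambda>k. i < phrase_start fs (Suc k) - 1"] k_def by auto
  qed (simp add: phrase_start_def)
  moreover have "1 \<le> phrase_start fs k" by (simp add: phrase_start_def)
  moreover have "k < length fs" using k(2) ne by linarith
  ultimately show ?thesis
    using k(1) by (intro that[of k "i - (phrase_start fs k - 1)"]) (auto simp: phrase_start_Suc)
qed

lemma nth_substring:
  assumes "1 \<le> q" "q + l - 1 \<le> length T" "t < l"
  shows "substring T q (q + l - 1) ! t = T ! (q - 1 + t)"
  using assms by (simp add: substring_def)

lemma bms_map_phrase:
  assumes "k < length fs" "t < length (fs ! k)"
  shows "bms_map fs qs (phrase_start fs k + t) =
    (case qs ! k of None \<Rightarrow> 0 | Some q \<Rightarrow> q + t)"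
proof -
  have "1 \<le> phrase_start fs k" by (simp add: phrase_start_def)
  then show ?thesis
    using nth_phrase(2)[OF assms] phrase_at_eqI[OF assms]
    by (auto simp: bms_map_def split: option.split)
qed

text \<open>The rank of a position is the number of steps it takes to reach the sink. Breaks occur
  only at phrase starts, since sources advance in step inside a copied phrase and ground phrases
  have length 1.\<close>

lemma macro_map_of_valid_bms:
  assumes "valid_bms T fs qs"
  obtains F where "macro_map T F" "card (breaks (length T) F) \<le> length fs"
proof -
  define f where "f = bms_map fs qs"
  define F where "F i = (if f (Suc i) = 0 then None else Some (f (Suc i) - 1))" for i
  define h where "h i = (LEAST m. (f ^^ m) (Suc i) = 0)" for i
  have T: "concat fs = T" "length qs = length fs"
    using assms by (auto simp: valid_bms_def bms_def)
  have reach: "\<exists>m. (f ^^ m) (Suc i) = 0" if "i < length T" for i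
    using assms that by (force simp: valid_bms_def f_def)
  have phrase: "F (phrase_start fs k - 1 + t) = map_option (\<lambda>q. q - 1 + t) (qs ! k) \<and>
      (\<forall>q. qs ! k = Some q \<longrightarrow> 1 \<le> q \<and> q - 1 + t < length T \<and> T ! (q - 1 + t) = fs ! k ! t)"
    if k: "k < length fs" "t < length (fs ! k)" for k t
  proof -
    have "Suc (phrase_start fs k - 1 + t) = phrase_start fs k + t"
      by (simp add: phrase_start_def)
    then have f: "f (Suc (phrase_start fs k - 1 + t)) = (case qs ! k of None \<Rightarrow> 0 | Some q \<Rightarrow> q + t)"
      using bms_map_phrase[OF k] by (simp only: f_def)
    have src: "1 \<le> q \<and> q - 1 + t < length T \<and> T ! (q - 1 + t) = fs ! k ! t"
      if q: "qs ! k = Some q" for q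
    proof -
      have b: "1 \<le> q" "q + length (fs ! k) - 1 \<le> length T"
          "fs ! k = substring T q (q + length (fs ! k) - 1)"
        using assms k(1) q unfolding valid_bms_def bms_def by (auto dest!: spec[of _ k])
      then show ?thesis
        using nth_substring[OF b(1,2) k(2)] k(2) by auto
    qed
    show ?thesis
      using f src by (cases "qs ! k") (auto simp: F_def)
  qed
  have "j < length T \<and> T ! j = T ! i \<and> h j < h i" if i: "i < length T" and j: "F i = Some j" for i j
  proof -
    obtain k t where k: "k < length fs" "t < length (fs ! k)" "i = phrase_start fs k - 1 + t"
      using ex_phrase i T by metis
    have jT: "j < length T \<and> T ! j = T ! i"
      using phrase[OF k(1,2)] nth_phrase(1)[OF k(1,2)] j k(3) T(1) by auto
    have fi: "f (Suc i) = Suc j" using j by (auto simp: F_def split: if_splits)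
    have hi: "(f ^^ h i) (Suc i) = 0"
      unfolding h_def by (rule LeastI_ex) (rule reach[OF i])
    then obtain m where m: "h i = Suc m" by (cases "h i") auto
    have "(f ^^ m) (Suc j) = 0" using hi fi by (simp add: m funpow_swap1)
    then have "h j \<le> m" unfolding h_def by (rule Least_le)
    then show ?thesis using jT m by simp
  qed
  then have "macro_map T F" unfolding macro_map_def by blast
  moreover have "breaks (length T) F \<subseteq> (\<lambda>k. phrase_start fs k - 1) ` {..<length fs}"
  proof
    fix i assume i: "i \<in> breaks (length T) F"
    then obtain k t where k: "k < length fs" "t < length (fs ! k)" "i = phrase_start fs k - 1 + t"
      using ex_phrase T by (metis (no_types, lifting) breaks_def mem_Collect_eq)
    have "t = 0"
    proof (rule ccontr)
      assume "t \<noteq> 0"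
      then obtain t' where t': "t = Suc t'" by (cases t) auto
      have "length (fs ! k) = 1" if "qs ! k = None"
        using assms k(1) that unfolding valid_bms_def bms_def by (auto dest!: spec[of _ k])
      then have "qs ! k \<noteq> None" using k(2) t' by auto
      then show False
        using phrase[OF k(1,2)] phrase[OF k(1), of t'] k i t' by (auto simp: breaks_def)
    qed
    then show "i \<in> (\<lambda>k. phrase_start fs k - 1) ` {..<length fs}" using k by auto
  qed
  then have "card (breaks (length T) F) \<le> length fs"
    using card_mono[of "(\<lambda>k. phrase_start fs k - 1) ` {..<length fs}"] card_image_le[of "{..<length fs}"]
    by (metis card_lessThan finite_imageI finite_lessThan order_trans)
  ultimately show ?thesis using that by blast
qed

text \<open>Reading from left to right, each character opens a new phrase if its position is in
  \<open>B\<close> and extends the last phrase otherwise. Having 0 in \<open>B\<close> ensures that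
  there is a phrase to extend.\<close>

lemma ex_factorization:
  assumes "T \<noteq> [] \<Longrightarrow> 0 \<in> B"
  shows "\<exists>fs. concat fs = T \<and> length fs = card (B \<inter> {..<length T}) \<and> [] \<notin> set fs \<and>
    (\<forall>k<length fs. \<forall>t. 0 < t \<and> t < length (fs ! k) \<longrightarrow> phrase_start fs k - 1 + t \<notin> B)"
  using assms
proof (induction T rule: rev_induct)
  case (snoc x T)
  then obtain fs where fs: "concat fs = T" "length fs = card (B \<inter> {..<length T})" "[] \<notin> set fs"
    "\<And>k t. k < length fs \<Longrightarrow> 0 < t \<Longrightarrow> t < length (fs ! k) \<Longrightarrow> phrase_start fs k - 1 + t \<notin> B"
    by auto
  show ?case
  proof (cases "length T \<in> B")
    case True
    have "B \<inter> {..<length (T @ [x])} = insert (length T) (B \<inter> {..<length T})"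
      using True by auto
    moreover have "phrase_start (fs @ [[x]]) k = phrase_start fs k" if "k < length fs" for k
      using that by (simp add: phrase_start_eq)
    ultimately show ?thesis
      using fs by (intro exI[of _ "fs @ [[x]]"]) (auto simp: nth_append less_Suc_eq)
  next
    case False
    then have B: "B \<inter> {..<length (T @ [x])} = B \<inter> {..<length T}"
      by (auto simp: less_Suc_eq)
    have "T \<noteq> []" using False snoc.prems by auto
    then have "fs \<noteq> []" using fs by auto
    then obtain gs g where g: "fs = gs @ [g]" by (metis rev_exhaust)
    let ?fs = "gs @ [g @ [x]]"
    have ps: "phrase_start ?fs k = phrase_start fs k" if "k < length fs" for k
      using that by (simp add: phrase_start_eq g)
    have "phrase_start ?fs k - 1 + t \<notin> B"
      if k: "k < length fs" "0 < t" "t < length (?fs ! k)" for k t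
    proof (cases "t < length (fs ! k)")
      case True
      then show ?thesis using fs(4) k ps by auto
    next
      case False
      then have "k = length gs" "t = length g"
        using k by (auto simp: g nth_append split: if_splits)
      then have "phrase_start ?fs k - 1 + t = length T"
        using fs(1) by (auto simp: phrase_start_eq g)
      then show ?thesis using \<open>length T \<notin> B\<close> by simp
    qed
    then show ?thesis
      using fs B by (intro exI[of _ ?fs]) (auto simp: g)
  qed
qed simp

text \<open>Cutting at the breaks yields a scheme: inside a piece the sources advance in step, so
  the piece is a copy of one substring. The decreasing rank rules out that a phrase is its own
  source and makes every chain end.\<close>

lemma min_bms_le_breaks:
  assumes "macro_map T F"
  shows "min_bms T \<le> card (breaks (length T) F)"
proof -
  let ?B = "breaks (length T) F"
  obtain h :: "nat \<Rightarrow> nat" where h: "\<And>i j. i < length T \<Longrightarrow> F i = Some j \<Longrightarrow>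
      j < length T \<and> T ! j = T ! i \<and> h j < h i"
    using assms unfolding macro_map_def by blast
  have "?B \<inter> {..<length T} = ?B" by (auto simp: breaks_def)
  then obtain fs where fs: "concat fs = T" "length fs = card ?B" "[] \<notin> set fs"
    "\<And>k t. k < length fs \<Longrightarrow> 0 < t \<Longrightarrow> t < length (fs ! k) \<Longrightarrow> phrase_start fs k - 1 + t \<notin> ?B"
    using ex_factorization[of T ?B] by (auto simp: breaks_def)
  define qs where "qs = map (\<lambda>k. map_option Suc (F (phrase_start fs k - 1))) [0..<length fs]"
  have T: "phrase_start fs k - 1 + t < length T" "T ! (phrase_start fs k - 1 + t) = fs ! k ! t"
    if "k < length fs" "t < length (fs ! k)" for k t
    using nth_phrase[OF that] fs(1) by (auto simp: phrase_start_def)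
  have nb: "\<exists>j. F (phrase_start fs k - 1 + t) = Some j \<and> F (phrase_start fs k - 1 + Suc t) = Some (Suc j)"
    if "k < length fs" "Suc t < length (fs ! k)" for k t
    using fs(4)[OF that(1), of "Suc t"] T(1)[OF that] that
    by (auto simp: breaks_def)
  have F: "F (phrase_start fs k - 1 + t) = map_option (\<lambda>q. q - 1 + t) (qs ! k)"
    if "k < length fs" "t < length (fs ! k)" for k t
    using that
  proof (induction t)
    case 0
    then show ?case by (cases "F (phrase_start fs k - 1)") (auto simp: qs_def)
  next
    case (Suc t)
    then show ?case using nb[of k t] by (cases "qs ! k") auto
  qed
  have pos: "0 < length (fs ! k)" if "k < length fs" for k
    using that fs(3) by (metis length_greater_0_conv nth_mem)
  have q1: "1 \<le> q" if "k < length fs" "qs ! k = Some q" for k q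
    using that by (auto simp: qs_def)
  have "bms T fs qs"
    unfolding bms_def
  proof (intro conjI allI impI)
    fix k assume k: "k < length fs"
    show "fs ! k \<noteq> []" using pos[OF k] by auto
    show "case qs ! k of None \<Rightarrow> length (fs ! k) = 1
         | Some q \<Rightarrow> 1 \<le> q \<and> q + length (fs ! k) - 1 \<le> length T \<and> q \<noteq> phrase_start fs k \<and>
             fs ! k = substring T q (q + length (fs ! k) - 1)"
    proof (cases "qs ! k")
      case None
      \<comment> \<open>A second position in the phrase would be a non-break, which forces the first
        position to have a source.\<close>
      then have "\<not> 1 < length (fs ! k)" using nb[OF k, of 0] F[OF k pos[OF k]] by auto
      then have "length (fs ! k) = 1" using pos[OF k] by linarith
      then show ?thesis using None by simp
    next
      case (Some q)
      have src: "q - 1 + t < length T" "T ! (q - 1 + t) = fs ! k ! t" if "t < length (fs ! k)" for t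
        using h[of "phrase_start fs k - 1 + t" "q - 1 + t"] T[OF k that] F[OF k that] Some by auto
      have b: "1 \<le> q" "q + length (fs ! k) - 1 \<le> length T"
        using q1[OF k Some] src(1)[of "length (fs ! k) - 1"] pos[OF k] by auto
      have "q \<noteq> phrase_start fs k"
        using h[of "phrase_start fs k - 1" "q - 1"] T(1)[OF k pos[OF k]] F[OF k pos[OF k]] Some by auto
      moreover have "length (substring T q (q + length (fs ! k) - 1)) = length (fs ! k)"
        using b pos[OF k] by (simp add: substring_def)
      then have "fs ! k = substring T q (q + length (fs ! k) - 1)"
        using nth_substring[OF b] src(2) by (metis nth_equalityI)
      ultimately show ?thesis using Some b by simp
    qed
  qed (use fs qs_def in auto)
  moreover have "\<exists>m\<ge>1. (bms_map fs qs ^^ m) (Suc i) = 0" if "i < length T" for i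
    using that
  proof (induction "h i" arbitrary: i rule: less_induct)
    case less
    obtain k t where k: "k < length fs" "t < length (fs ! k)" "i = phrase_start fs k - 1 + t"
      using ex_phrase less.prems fs(1) by metis
    have Si: "Suc i = phrase_start fs k + t" using k(3) by (simp add: phrase_start_def)
    show ?case
    proof (cases "qs ! k")
      case None
      then show ?thesis
        using bms_map_phrase[OF k(1,2), of qs] Si by (intro exI[of _ 1]) auto
    next
      case (Some q)
      then have j: "F i = Some (q - 1 + t)" using F[OF k(1,2)] k(3) by simp
      have st: "bms_map fs qs (Suc i) = Suc (q - 1 + t)"
        using bms_map_phrase[OF k(1,2), of qs] Si Some q1[OF k(1) Some] by simp
      obtain m where m: "(bms_map fs qs ^^ m) (Suc (q - 1 + t)) = 0"
        using less.hyps h[OF less.prems j] by blast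
      show ?thesis
        using m st by (intro exI[of _ "Suc m"]) (simp add: funpow_swap1)
    qed
  qed
  then have "\<forall>i\<in>{1..length T}. \<exists>m\<ge>1. (bms_map fs qs ^^ m) i = 0"
    by (metis Suc_le_eq Suc_pred' atLeastAtMost_iff less_eq_Suc_le One_nat_def)
  ultimately have "valid_bms T fs qs" unfolding valid_bms_def by blast
  then show ?thesis
    unfolding min_bms_def using fs(2) by (intro Least_le) blast
qed

lemma ex_macro_map_min_bms:
  obtains F where "macro_map T F" "card (breaks (length T) F) \<le> min_bms T"
proof -
  have "\<exists>fs qs. valid_bms T fs qs \<and> length fs = min_bms T"
    unfolding min_bms_def by (rule LeastI_ex) (use valid_bms_all_ground in blast)
  then show ?thesis using macro_map_of_valid_bms that by metis
qed

section \<open>Blocks\<close>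

text \<open>Blocks come from an arbitrary set \<open>S\<close> of cuts rather than from the breaks
  alone, so that cuts can be added at the edit.\<close>

definition block_start :: "nat set \<Rightarrow> nat \<Rightarrow> nat" where
  "block_start S i = Max {s \<in> S. s \<le> i}"

context
  fixes S :: "nat set"
  assumes S0: "0 \<in> S"
begin

lemma block_start_in: "block_start S i \<in> S" and block_start_le: "block_start S i \<le> i"
proof -
  have "block_start S i \<in> {s \<in> S. s \<le> i}"
    unfolding block_start_def using S0 by (intro Max_in) auto
  then show "block_start S i \<in> S" "block_start S i \<le> i" by auto
qed

lemma block_start_ge: "s \<in> S \<Longrightarrow> s \<le> i \<Longrightarrow> s \<le> block_start S i"
  unfolding block_start_def by (intro Max_ge) auto

lemma block_start_self: "s \<in> S \<Longrightarrow> block_start S s = s"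
  using block_start_ge[of s s] block_start_le[of s] by simp

lemma block_start_Suc: "Suc i \<notin> S \<Longrightarrow> block_start S (Suc i) = block_start S i"
  using block_start_ge[of "block_start S i" "Suc i"] block_start_ge[of "block_start S (Suc i)" i]
    block_start_in block_start_le[of i] block_start_le[of "Suc i"]
  by (metis le_SucE le_SucI le_antisym)

lemma block_start_between:
  "block_start S i \<le> j \<Longrightarrow> j \<le> i \<Longrightarrow> block_start S j = block_start S i"
  using block_start_ge[of "block_start S i" j] block_start_ge[of "block_start S j" i]
    block_start_in block_start_le[of j] by (meson le_antisym le_trans)

text \<open>\<open>F\<close> is a shift on each block, as all its breaks are cuts. A ground position
  is a block by itself, which gives the second conjunct.\<close>

lemma block_map:
  assumes "breaks n F \<subseteq> S" "i < n"
  shows "F i = map_option (\<lambda>q. q + (i - block_start S i)) (F (block_start S i)) \<and>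
    (i \<noteq> block_start S i \<longrightarrow> F (block_start S i) \<noteq> None)"
  using assms(2)
proof (induction i)
  case 0
  have "block_start S 0 = 0" using block_start_le[of 0] by simp
  then show ?case by (simp add: option.map_ident)
next
  case (Suc i)
  show ?case
  proof (cases "Suc i \<in> S")
    case True
    then show ?thesis by (simp add: block_start_self option.map_ident)
  next
    case False
    then obtain j where "F i = Some j" "F (Suc i) = Some (Suc j)"
      using nonbreakD assms(1) Suc.prems by (metis subsetD)
    then show ?thesis
      using Suc block_start_le[of i] block_start_Suc[OF False] by (auto simp: Suc_diff_le)
  qed
qed

end

text \<open>Distinct naturals sum to at least 0 + 1 + ... + (k - 1). In the induction, the new
  maximum lies above \<open>card A\<close> other naturals, hence is at least
  \<open>card A\<close>.\<close>

lemma card_le_sum_nat: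
  fixes A :: "nat set"
  assumes "finite A"
  shows "card A * (card A - 1) \<le> 2 * \<Sum>A"
  using assms
proof (induction A rule: finite_linorder_max_induct)
  case (insert b A)
  have "A \<subseteq> {..<b}" using insert by auto
  then have c: "card A \<le> b" by (metis card_lessThan card_mono finite_lessThan)
  have "b \<notin> A" using insert by auto
  moreover have "Suc (card A) * card A = card A * (card A - 1) + 2 * card A"
    by (cases "card A") auto
  ultimately show ?case using insert c by simp
qed simp

section \<open>Edits\<close>

text \<open>Every edit replaces some \<open>v\<close> by some \<open>v'\<close>, each of at most one
  character, so one argument covers all types. In the bound, \<open>m\<close> counts the
  representatives, each cut at most twice; 3 pays for cuts at both ends of \<open>v\<close> and for
  \<open>v'\<close> itself.\<close>

lemma macro_map_edit:
  fixes u v v' w :: "'a list"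
  assumes scheme: "macro_map (u @ v @ w) F" and v: "length v \<le> 1" "length v' \<le> 1"
  obtains F' m where "macro_map (u @ v' @ w) F'"
    "card (breaks (length (u @ v' @ w)) F') \<le> card (breaks (length (u @ v @ w)) F) + 2 * m + 3"
    "m * (m - 1) \<le> 2 * length (u @ v @ w)"
proof -

  \<comment> \<open>Cutting the old scheme at the edited position\<close>
  define T T' n n' p d d' where defs: "T = u @ v @ w" "T' = u @ v' @ w" "n = length T" "n' = length T'"
    "p = length u" "d = length v" "d' = length v'"
  have d: "d \<le> 1" "d' \<le> 1" "p + d \<le> n" "p + d' \<le> n'" "n' + d = n + d'"
    using v by (auto simp: defs)
  obtain h :: "nat \<Rightarrow> nat" where h: "\<And>i j. i < n \<Longrightarrow> F i = Some j \<Longrightarrow>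
      j < n \<and> T ! j = T ! i \<and> h j < h i"
    using scheme unfolding macro_map_def defs by blast
  define S where "S = breaks n F \<union> {p, p + d}"
  \<comment> \<open>For \<open>n = 0\<close> there are no breaks, but then \<open>p = 0\<close> is
    in \<open>S\<close>.\<close>
  have S0: "0 \<in> S"
    using d by (cases "n = 0") (auto simp: S_def breaks_def)
  define st where "st = block_start S"
  note st_in = block_start_in[OF S0, folded st_def]
  note st_le = block_start_le[OF S0, folded st_def]
  note st_ge = block_start_ge[OF S0, folded st_def]
  note st_self = block_start_self[OF S0, folded st_def]
  note st_Suc = block_start_Suc[OF S0, folded st_def]
  note st_between = block_start_between[OF S0, folded st_def]
  have block: "F i = map_option (\<lambda>q. q + (i - st i)) (F (st i))" "i \<noteq> st i \<Longrightarrow> F (st i) \<noteq> None"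
    if "i < n" for i
    using block_map[OF S0 _ that, of F, folded st_def] by (auto simp: S_def)

  \<comment> \<open>Harmed blocks and their longest representatives\<close>
  define bad where "bad s \<longleftrightarrow> (\<exists>i<n. st i = s \<and> i \<noteq> s \<and> (F i = Some p \<or> F i = Some (p + d)))" for s
  \<comment> \<open>A block is bad if its source reaches \<open>p\<close> or \<open>p + d\<close>
    after its first position. That \<open>r\<close> starts a longest bad block for \<open>q\<close>
    is expressed by offsets: each offset in such a block also occurs in the block of
    \<open>r\<close>.\<close>
  have "\<exists>r. bad r \<and> F r = Some q \<and> (\<forall>s i. bad s \<longrightarrow> F s = Some q \<longrightarrow> i < n \<longrightarrow> st i = s \<longrightarrow>
      r + (i - s) < n \<and> st (r + (i - s)) = r)" if ex: "\<exists>s. bad s \<and> F s = Some q" for q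
  proof -
    let ?P = "\<lambda>l. \<exists>s i. bad s \<and> F s = Some q \<and> i < n \<and> st i = s \<and> l = i - s"
    have "\<exists>l. ?P l" using ex unfolding bad_def by blast
    moreover have "\<forall>l. ?P l \<longrightarrow> l \<le> n" by auto
    ultimately obtain l where l: "?P l" "\<And>l'. ?P l' \<Longrightarrow> l' \<le> l"
      using Nat.ex_has_greatest_nat[of ?P _ n] by blast
    obtain r k where r: "bad r" "F r = Some q" "k < n" "st k = r" "l = k - r" using l(1) by blast
    have "r + (i - s) < n \<and> st (r + (i - s)) = r" if "bad s" "F s = Some q" "i < n" "st i = s" for s i
    proof -
      have "i - s \<le> k - r" using l(2)[of "i - s"] that r(5) by blast
      then have "r + (i - s) \<le> k" using st_le[of k] r(4) by simp
      then show ?thesis using st_between[of k "r + (i - s)"] r by simp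
    qed
    then show ?thesis using r by blast
  qed
  then obtain rep where rep: "\<And>q. \<exists>s. bad s \<and> F s = Some q \<Longrightarrow> bad (rep q) \<and> F (rep q) = Some q \<and>
      (\<forall>s i. bad s \<longrightarrow> F s = Some q \<longrightarrow> i < n \<longrightarrow> st i = s \<longrightarrow>
        rep q + (i - s) < n \<and> st (rep q + (i - s)) = rep q)"
    by metis
  \<comment> \<open>The representatives, and the positions redirected to one.\<close>
  define R where "R = {s. bad s \<and> (\<exists>q. F s = Some q \<and> rep q = s)}"
  define red where "red i \<longleftrightarrow> bad (st i) \<and> st i \<notin> R" for i
  define tgt where "tgt i = rep (the (F (st i))) + (i - st i)" for i
  define mid where "mid i \<longleftrightarrow> p \<le> i \<and> i < p + d" for i
  \<comment> \<open>The new map, still in the positions of the old text.\<close>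
  define G where "G i = (case F i of None \<Rightarrow> None | Some j \<Rightarrow>
      if red i then Some (tgt i) else if mid j then None else Some j)" for i

  have bad_lt: "s < n" "st s = s" "F s \<noteq> None" "\<not> mid s" if b: "bad s" for s
  proof -
    obtain i where i: "i < n" "st i = s" "i \<noteq> s" using b bad_def by blast
    show "s < n" "st s = s" using i st_le[of i] st_in[of i] st_self by auto
    show "F s \<noteq> None" using block(2)[OF i(1)] i by simp
    \<comment> \<open>A bad block has at least two positions, whereas \<open>v\<close> gives a block
      of at most one, \<open>p + d\<close> being a cut.\<close>
    have "s < i" using i st_le[of i] by auto
    then show "\<not> mid s"
      using st_ge[of "p + d" i] i(2) d unfolding mid_def S_def by auto
  qed
  have not_mid: "\<not> mid i" if "st i = s" "\<not> mid s" for i s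
  proof
    assume "mid i"
    then have "i = p" using d by (auto simp: mid_def)
    then show False using st_self[of p] that \<open>mid i\<close> by (auto simp: S_def)
  qed
  have red: "tgt i < n" "F (tgt i) = F i" "\<not> red (tgt i)" "\<not> mid (tgt i)"
      "st (tgt i) = tgt i - (i - st i)"
    if i: "i < n" "red i" for i
  proof -
    have b: "bad (st i)" using i red_def by blast
    obtain q where q: "F (st i) = Some q" using bad_lt(3)[OF b] by auto
    have r: "bad (rep q)" "F (rep q) = Some q" "rep q + (i - st i) < n" "st (rep q + (i - st i)) = rep q"
      using rep[of q] b q i(1) by blast+
    have t: "tgt i = rep q + (i - st i)" by (simp add: tgt_def q)
    show "tgt i < n" "st (tgt i) = tgt i - (i - st i)" using r t by auto
    show "F (tgt i) = F i" using block(1)[OF i(1)] block(1)[OF r(3)] r q t by simp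
    \<comment> \<open>Representatives are not redirected, so a redirection never leads straight into
      another one.\<close>
    have "rep q \<in> R" using r R_def by blast
    then show "\<not> red (tgt i)" using r t red_def by simp
    show "\<not> mid (tgt i)" using not_mid[OF r(4)] bad_lt(4)[OF r(1)] t by simp
  qed

  \<comment> \<open>The redirected map keeps characters and lowers the rank\<close>
  have G: "j < n \<and> T ! j = T ! i \<and> \<not> mid j" if i: "i < n" "G i = Some j" for i j
  proof -
    obtain k where k: "F i = Some k" using i(2) by (auto simp: G_def split: option.splits)
    show ?thesis
    proof (cases "red i")
      case True
      then have j: "j = tgt i" using i k by (simp add: G_def)
      \<comment> \<open>Both positions have the same old source \<open>k\<close>, hence the same
        character.\<close>
      have "T ! tgt i = T ! i"
        using h[of i k] h[of "tgt i" k] red(1,2)[OF i(1) True] i(1) k by metis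
      then show ?thesis using red[OF i(1) True] j by simp
    qed (use i k h in \<open>auto simp: G_def split: if_splits\<close>)
  qed
  \<comment> \<open>The factor 2 makes room for the representative between a redirected position and its old source.\<close>
  define g where "g i = (case F i of None \<Rightarrow> 0 | Some j \<Rightarrow> 2 * h j + (if red i then 2 else 1))" for i
  have g: "g j < g i" if i: "i < n" "G i = Some j" for i j
  proof -
    obtain k where k: "F i = Some k" using i(2) by (auto simp: G_def split: option.splits)
    show ?thesis
    proof (cases "red i")
      case True
      then have "j = tgt i" using i k by (simp add: G_def)
      then show ?thesis using red[OF i(1) True] k True by (simp add: g_def)
    next
      case False
      then have "j = k" using i k by (simp add: G_def split: if_splits)
      moreover have "h l < h j" if "F j = Some l" for l
        using h[OF _ that] h[OF i(1) k] \<open>j = k\<close> by blast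
      ultimately show ?thesis using k False by (force simp: g_def split: option.split)
    qed
  qed

  \<comment> \<open>Transfer to the positions of the new text\<close>
  define \<phi> where "\<phi> i = (if i < p then i else i - d + d')" for i
  define \<psi> where "\<psi> x = (if x < p then x else x - d' + d)" for x
  define F' where "F' x = (if p \<le> x \<and> x < p + d' then None else map_option \<phi> (G (\<psi> x)))" for x
  \<comment> \<open>\<open>\<phi>\<close> and \<open>\<psi>\<close> are mutually inverse between the
    positions outside \<open>v\<close> and those outside \<open>v'\<close>; nothing is claimed about
    their values elsewhere.\<close>
  have \<psi>: "\<psi> x < n" "\<not> mid (\<psi> x)" "\<phi> (\<psi> x) = x" "T' ! x = T ! \<psi> x"
    if "x < n'" "\<not> (p \<le> x \<and> x < p + d')" for x
    using that d by (auto simp: \<phi>_def \<psi>_def mid_def defs nth_append add.commute)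
  have \<phi>: "\<phi> i < n'" "\<not> (p \<le> \<phi> i \<and> \<phi> i < p + d')" "\<psi> (\<phi> i) = i"
    if "i < n" "\<not> mid i" for i
    using that d by (auto simp: \<phi>_def \<psi>_def mid_def)
  have "macro_map T' F'"
    unfolding macro_map_def
  proof (intro exI[of _ "g \<circ> \<psi>"] allI impI)
    fix x y assume x: "x < length T'" and y: "F' x = Some y"
    have nx: "\<not> (p \<le> x \<and> x < p + d')" using y by (auto simp: F'_def split: if_splits)
    obtain j where j: "G (\<psi> x) = Some j" "y = \<phi> j" using y by (auto simp: F'_def split: if_splits)
    note P = \<psi>[OF x[folded defs(4)] nx]
    have Gj: "j < n" "T ! j = T ! \<psi> x" "\<not> mid j" using G[OF P(1) j(1)] by auto
    note Q = \<phi>[OF Gj(1,3)]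
    show "y < length T' \<and> T' ! y = T' ! x \<and> (g \<circ> \<psi>) y < (g \<circ> \<psi>) x"
      using Q P(4) \<psi>(4)[OF Q(1,2)] Gj g[OF P(1) j(1)] j(2) by (simp add: defs(4))
  qed

  \<comment> \<open>Counting the representatives\<close>
  define a where "a s = p - the (F s)" for s
  have R: "s + a s < n \<and> st (s + a s) = s \<and> the (F s) \<le> p" if s: "s \<in> R" for s
  proof -
    have b: "bad s" using s R_def by blast
    then obtain i where i: "i < n" "st i = s" "i \<noteq> s" "F i = Some p \<or> F i = Some (p + d)"
      using bad_def by blast
    obtain q where q: "F s = Some q" using bad_lt(3)[OF b] by auto
    have si: "s < i" using i st_le[of i] by auto
    \<comment> \<open>The offset \<open>i - s\<close> is at least 1 and \<open>d\<close> is at most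
      1, so \<open>q \<le> p\<close> in both cases and \<open>p - q\<close> is not
      truncated.\<close>
    have "q + (i - s) = p \<or> q + (i - s) = p + d" using block(1)[OF i(1)] i q by auto
    then have "q \<le> p" "s + (p - q) \<le> i" using si d(1) by auto
    then show ?thesis using st_between[of i "s + (p - q)"] i by (auto simp: a_def q)
  qed
  have R_lt: "R \<subseteq> {..<n}" using bad_lt(1) R_def by blast
  then have finR: "finite R" using finite_subset by blast
  \<comment> \<open>Each \<open>q\<close> has one representative, and \<open>p - q\<close>
    determines \<open>q\<close> because \<open>q \<le> p\<close>.\<close>
  have inj_a: "inj_on a R"
  proof (rule inj_onI)
    fix s t assume st: "s \<in> R" "t \<in> R" "a s = a t"
    obtain q q' where q: "F s = Some q" "rep q = s" "F t = Some q'" "rep q' = t"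
      using st unfolding R_def by blast
    then have "q = q'" using st R[of s] R[of t] by (auto simp: a_def)
    then show "s = t" using q by simp
  qed
  define m where "m = card R"
  have "\<Sum>(a ` R) = (\<Sum>s\<in>R. a s)" using inj_a by (simp add: sum.reindex)
  \<comment> \<open>Pairs of a representative and an offset below \<open>a s\<close> name distinct
    positions of the text, since blocks are disjoint.\<close>
  also have "\<dots> = card (SIGMA s:R. {..<a s})" using finR by simp
  also have "\<dots> \<le> card {..<n}"
  proof (rule card_inj_on_le[where f = "\<lambda>(s, t). s + t"])
    have *: "st (s + t) = s \<and> s + t < n" if "s \<in> R" "t < a s" for s t
      using st_between[of "s + a s" "s + t"] R[OF that(1)] that(2) by simp
    show "inj_on (\<lambda>(s, t). s + t) (SIGMA s:R. {..<a s})"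
    proof (rule inj_onI)
      fix x y
      assume xy: "x \<in> (SIGMA s:R. {..<a s})" "y \<in> (SIGMA s:R. {..<a s})"
        "(case x of (s, t) \<Rightarrow> s + t) = (case y of (s, t) \<Rightarrow> s + t)"
      then have "fst x = fst y"
        using *[of "fst x" "snd x"] *[of "fst y" "snd y"] by (auto simp: case_prod_beta)
      then show "x = y" using xy(3) by (simp add: case_prod_beta prod_eq_iff)
    qed
    show "(\<lambda>(s, t). s + t) ` (SIGMA s:R. {..<a s}) \<subseteq> {..<n}" using * by auto
  qed simp
  finally have "\<Sum>(a ` R) \<le> n" by simp
  then have m_le: "m * (m - 1) \<le> 2 * n"
    using card_le_sum_nat[of "a ` R"] finR inj_a by (simp add: card_image m_def)

  \<comment> \<open>Counting the breaks of the new map\<close>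
  define E where "E = (\<lambda>s. s + a s) ` R \<union> (\<lambda>s. s + a s + d) ` R"
  \<comment> \<open>Past the start of a block, a reference that is not redirected meets
    \<open>p\<close> or \<open>p + d\<close> only in a representative, at offset \<open>a s\<close>
    or \<open>a s + d\<close>.\<close>
  have E: "i \<in> E" if i: "i < n" "i \<noteq> st i" "F i = Some p \<or> F i = Some (p + d)" "\<not> red i" for i
  proof -
    have "bad (st i)" using i bad_def by blast
    then have s: "st i \<in> R" using i(4) red_def by blast
    obtain q where q: "F (st i) = Some q" using block(2)[OF i(1,2)] by auto
    have "q \<le> p" using R[OF s] q by simp
    moreover have "q + (i - st i) = p \<or> q + (i - st i) = p + d"
      using block(1)[OF i(1)] i(3) q by auto
    ultimately have "i = st i + a (st i) \<or> i = st i + a (st i) + d"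
      using st_le[of i] q by (auto simp: a_def)
    then show ?thesis using s unfolding E_def by blast
  qed
  have cardE: "card E \<le> 2 * m"
    using card_Un_le[of "(\<lambda>s. s + a s) ` R" "(\<lambda>s. s + a s + d) ` R"]
      card_image_le[OF finR, of "\<lambda>s. s + a s"] card_image_le[OF finR, of "\<lambda>s. s + a s + d"]
    by (simp add: E_def m_def)

  have nonbreak: "\<exists>j. G (i - 1) = Some j \<and> G i = Some (Suc j) \<and> \<phi> (Suc j) = Suc (\<phi> j) \<and> \<not> mid (i - 1)"
    if i: "i < n" "i \<notin> S" "i \<notin> E" "\<not> mid i" for i
  proof -
    obtain k where k: "i = Suc k" using i S0 by (cases i) auto
    have stk: "st i = st k" using st_Suc i k by simp
    have nst: "i \<noteq> st i" using st_in[of i] i by metis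
    have mk: "\<not> mid k" using i(2,4) k by (auto simp: mid_def S_def)
    obtain j where j: "F k = Some j" "F i = Some (Suc j)"
      using nonbreakD[of k n F] i k by (auto simp: S_def)
    have rk: "red k \<longleftrightarrow> red i" by (simp add: red_def stk)
    show ?thesis
    proof (cases "red i")
      case True
      have t: "tgt i = Suc (tgt k)" unfolding tgt_def stk using st_le[of k] k by (simp add: Suc_diff_le)
      \<comment> \<open>The offset of \<open>tgt i\<close> in its block is positive. So
        \<open>tgt i\<close> is neither \<open>p\<close> nor \<open>p + d\<close>, the only places
        where \<open>\<phi>\<close> can fail to advance by 1.\<close>
      have "tgt i \<notin> S"
        using red(5)[OF i(1) True] st_self[of "tgt i"] st_le[of i] nst t by linarith
      then have "\<phi> (Suc (tgt k)) = Suc (\<phi> (tgt k))"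
        using t red(4)[OF i(1) True] by (auto simp: \<phi>_def S_def mid_def)
      then show ?thesis using True rk j t mk k by (simp add: G_def)
    next
      case False
      then have "Suc j \<noteq> p" "Suc j \<noteq> p + d" using E[OF i(1) nst] i(3) j by auto
      then have "\<not> mid j" "\<not> mid (Suc j)" "\<phi> (Suc j) = Suc (\<phi> j)"
        using d(1) by (auto simp: mid_def \<phi>_def)
      then show ?thesis using False rk j mk k by (simp add: G_def)
    qed
  qed
  have "breaks n' F' \<subseteq> {p..<p + d'} \<union> \<phi> ` (S \<union> E)"
  proof
    fix x assume x: "x \<in> breaks n' F'"
    show "x \<in> {p..<p + d'} \<union> \<phi> ` (S \<union> E)"
    proof (rule ccontr)
      assume nx: "x \<notin> {p..<p + d'} \<union> \<phi> ` (S \<union> E)"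
      have x': "x < n'" "\<not> (p \<le> x \<and> x < p + d')" using x nx by (auto simp: breaks_def)
      note P = \<psi>[OF x']
      have nS: "\<psi> x \<notin> S" "\<psi> x \<notin> E" using nx P(3) by (metis UnI1 UnI2 imageI)+
      obtain j where j: "G (\<psi> x - 1) = Some j" "G (\<psi> x) = Some (Suc j)" "\<phi> (Suc j) = Suc (\<phi> j)"
          "\<not> mid (\<psi> x - 1)"
        using nonbreak[OF P(1) nS P(2)] by blast
      have "\<psi> x \<noteq> 0" using nS(1) S0 by metis
      moreover have "\<psi> x \<noteq> p" "\<psi> x \<noteq> p + d" using nS(1) by (auto simp: S_def)
      ultimately have "x \<noteq> 0" "\<psi> (x - 1) = \<psi> x - 1" "\<not> (p \<le> x - 1 \<and> x - 1 < p + d')"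
        using x'(2) by (auto simp: \<psi>_def split: if_splits)
      then have "F' (x - 1) = Some (\<phi> j)" "F' x = Some (Suc (\<phi> j))"
        using j x'(2) unfolding F'_def by auto
      then show False using x \<open>x \<noteq> 0\<close> by (auto simp: breaks_def)
    qed
  qed
  then have "card (breaks n' F') \<le> card ({p..<p + d'} \<union> \<phi> ` (S \<union> E))"
    by (intro card_mono) (auto simp: S_def E_def finR)
  also have "\<dots> \<le> card {p..<p + d'} + card (S \<union> E)"
    using card_Un_le[of "{p..<p + d'}" "\<phi> ` (S \<union> E)"] card_image_le[of "S \<union> E" \<phi>] finR
    by (simp add: S_def E_def)
  \<comment> \<open>The 1 is for \<open>v'\<close> and the 2 for the cuts at \<open>p\<close> and
    \<open>p + d\<close>; \<open>cardE\<close> supplies \<open>2 * m\<close>.\<close>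
  also have "\<dots> \<le> 1 + ((card (breaks n F) + 2) + card E)"
    using d(2) card_Un_le[of S E] card_Un_le[of "breaks n F" "{p, p + d}"]
      card_insert_le_m1[of 2 "{p + d}" p] unfolding S_def by simp
  finally show thesis
    using that[of F' m] \<open>macro_map T' F'\<close> m_le cardE by (simp add: defs)
qed

text \<open>The bound on \<open>m * (m - 1)\<close> yields \<open>m \<le> 1 + 2 * sqrt n\<close> for
  the old length \<open>n\<close>, whence \<open>2 * m + 3 \<le> 5 + 4 * sqrt n\<close>.\<close>

lemma min_bms_edit_le:
  fixes u v v' w :: "'a list"
  assumes "length v \<le> 1" "length v' \<le> 1"
  shows "real (min_bms (u @ v' @ w)) \<le> real (min_bms (u @ v @ w)) + 5 + 4 * sqrt (length (u @ v @ w))"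
proof -
  let ?n = "length (u @ v @ w)"
  obtain F where F: "macro_map (u @ v @ w) F" "card (breaks ?n F) \<le> min_bms (u @ v @ w)"
    using ex_macro_map_min_bms by blast
  obtain F' m where F': "macro_map (u @ v' @ w) F'"
    "card (breaks (length (u @ v' @ w)) F') \<le> card (breaks ?n F) + 2 * m + 3"
    and m: "m * (m - 1) \<le> 2 * ?n"
    using macro_map_edit[OF F(1) assms] by blast
  have "real m - 1 \<le> 2 * sqrt ?n"
  proof (cases m)
    case 0
    then show ?thesis using real_sqrt_ge_zero[of "real ?n"] by linarith
  next
    case (Suc k)
    \<comment> \<open>The factor 4 is generous; being a square, it leaves the root with an integer
      coefficient.\<close>
    have "k * k \<le> 4 * ?n" using m Suc by simp
    then have "real (k * k) \<le> real (4 * ?n)" by (rule of_nat_mono)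
    then have "(real k)\<^sup>2 \<le> 4 * real ?n" by (simp add: power2_eq_square)
    then have "real k \<le> sqrt (4 * real ?n)" by (rule real_le_rsqrt)
    also have "\<dots> = 2 * sqrt (real ?n)" by (simp only: real_sqrt_mult real_sqrt_four)
    finally show ?thesis using Suc by simp
  qed
  moreover have "min_bms (u @ v' @ w) \<le> min_bms (u @ v @ w) + 2 * m + 3"
    using min_bms_le_breaks[OF F'(1)] F(2) F'(2) by simp
  then have "real (min_bms (u @ v' @ w)) \<le> real (min_bms (u @ v @ w) + 2 * m + 3)"
    by (rule of_nat_mono)
  ultimately show ?thesis by simp
qed

lemma edits_decomp:
  assumes "T' \<in> edits e T"
  obtains u v v' w where "T = u @ v @ w" "T' = u @ v' @ w" "length v \<le> 1" "length v' \<le> 1"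
proof (cases e)
  case Sub
  then obtain i c where "i < length T" "T' = T[i := c]" using assms by auto
  then have "T = take i T @ [T ! i] @ drop (Suc i) T" "T' = take i T @ [c] @ drop (Suc i) T"
    by (simp_all add: Cons_nth_drop_Suc upd_conv_take_nth_drop)
  then show ?thesis by (rule that) simp_all
next
  case Ins
  then obtain i c where "i \<le> length T" "T' = take i T @ c # drop i T" using assms by auto
  then have "T = take i T @ [] @ drop i T" "T' = take i T @ [c] @ drop i T" by simp_all
  then show ?thesis by (rule that) simp_all
next
  case Del
  then obtain i where "i < length T" "T' = take i T @ drop (Suc i) T" using assms by auto
  then have "T = take i T @ [T ! i] @ drop (Suc i) T" "T' = take i T @ [] @ drop (Suc i) T"
    by (simp_all add: Cons_nth_drop_Suc)
  then show ?thesis by (rule that) simp_all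
qed

text \<open>Exchanging \<open>v\<close> and \<open>v'\<close> inverts the edit and bounds the
  difference from below. There the root is that of the new length, at most
  \<open>2 * sqrt n\<close>, so the constant is 5 + 4 * 2 = 13, with 5 absorbed by
  \<open>1 \<le> sqrt n\<close>.\<close>

lemma edit_diffs_min_bms_bound:
  assumes "x \<in> edit_diffs e (min_bms :: 'a list \<Rightarrow> nat) n" "1 \<le> n"
  shows "\<bar>real_of_int x\<bar> \<le> 13 * sqrt n"
proof -
  obtain T T' :: "'a list" where x: "x = int (min_bms T') - int (min_bms T)" "length T = n"
    and e: "T' \<in> edits e T"
    using assms(1) unfolding edit_diffs_def by blast
  obtain u v v' w where d: "T = u @ v @ w" "T' = u @ v' @ w" "length v \<le> 1" "length v' \<le> 1"
    by (rule edits_decomp[OF e])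
  have "real (length T') \<le> 4 * real n"
    using length_edits[OF e] x(2) assms(2) by simp
  then have "sqrt (length T') \<le> 2 * sqrt n"
    using real_sqrt_le_mono[of "length T'" "4 * real n"] real_sqrt_mult[of 4 "real n"] by simp
  moreover have "real (min_bms T') \<le> real (min_bms T) + 5 + 4 * sqrt n"
    using min_bms_edit_le[OF d(3,4)] d x(2) by metis
  moreover have "real (min_bms T) \<le> real (min_bms T') + 5 + 4 * sqrt (length T')"
    using min_bms_edit_le[OF d(4,3)] d by metis
  moreover have "1 \<le> sqrt n" using assms(2) by simp
  ultimately show ?thesis unfolding x(1) of_int_diff of_int_of_nat_eq by linarith
qed

theorem theorem4:
  fixes e :: edit
  shows "(\<lambda>n. real_of_int (AS e (min_bms :: 'a list \<Rightarrow> nat) n)) \<in> O(\<lambda>n. sqrt (real n))"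
proof (rule bigoI[of _ 13], rule eventually_sequentiallyI[of 1])
  \<comment> \<open>The bound fails for \<open>n = 0\<close>: inserting into the empty string costs
    one phrase, but the square root vanishes.\<close>
  fix n :: nat assume n: "1 \<le> n"
  let ?D = "edit_diffs e (min_bms :: 'a list \<Rightarrow> nat) n"
  have "Max ?D \<in> ?D" if "?D \<noteq> {}"
    using Max_in[OF finite_edit_diffs_min_bms that] .
  then show "norm (real_of_int (AS e (min_bms :: 'a list \<Rightarrow> nat) n)) \<le> 13 * norm (sqrt (real n))"
    using edit_diffs_min_bms_bound[OF _ n, of "Max ?D" e] by (auto simp: AS_def)
qed

end
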